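(* Let $T=\{x_1,\dots,x_n\}$ be a training set of uncertain objects with class labels $c$ and $c'$, and let $k\ge1$ be an integer. For any (certain or uncertain) test object $q$, it holds that $$\Pr\big(D(q,c)<D(q,c')\big)=\int_{R^q_{min}}^{R^q_{max}}\Pr\big(D_q(c)=R\big)\cdot\Pr\big(D_q(c')>R\big)\,\mathrm{d}R .$$
   Context: $(\mathbb{D},d)$ is a metric space (e.g. $\mathbb{R}^d$ with the Euclidean distance). A certain object is an element of $\mathbb{D}$. An uncertain object $x$ is a random variable with domain $\mathbb{D}$ and probability density function $f^x$; a certain object is regarded as an uncertain object concentrated at one point. The probability of an outcome $\{v_1,\dots,v_n\}$ of $T$ is $\prod_i f^{x_i}(v_i)$. The distance between two uncertain objects is a continuous random variable. Each uncertain object $x$ is associated with a finite region $\mathrm{SUP}(x)$ (a hyperball or a hypercube) containing the support of $x$, i.e. $\Pr(x\notin\mathrm{SUP}(x))=0$. (If the support is infinite, $\mathrm{SUP}(x)$ is such that $\Pr(x\notin\mathrm{SUP}(x))\le\alpha$ for a fixed small $\alpha$, and the probability of $x$ lying outside it is considered negligible.) For a certain object $q$, $\mathrm{SUP}(q)=\{q\}$. For objects $x,y$, $mindist(x,y)=\min\{d(v,w):v\in\mathrm{SUP}(x),\,w\in\mathrm{SUP}(y)\}$ and $maxdist(x,y)=\max\{d(v,w):v\in\mathrm{SUP}(x),\,w\in\mathrm{SUP}(y)\}$. $T_c$ is the set of training objects with label $c$. $D(q,c)$ is the random variable whose outcome is the distance between $q$ and its $k$-th nearest neighbor among the training objects with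 label $c$. For certain $q$, with $p_i(R)=\Pr(d(q,x_i)\le R)$, its cumulative distribution function is $$\Pr(D(q,c)\le R)=1-\sum_{S\subseteq T_c:\,|S|<k}\Big(\prod_{x_i\in S}p_i(R)\Big)\Big(\prod_{x_i\in T_c\setminus S}(1-p_i(R))\Big).$$ For certain $q$, $\Pr(D(q,c)<D(q,c'))=\int_0^{+\infty}\Pr(D(q,c)=R)\Pr(D(q,c')>R)\,dR$; for an uncertain test object $u$, $\Pr(D(u,c)<D(u,c'))=\int_{\mathbb{D}}f^u(q)\Pr(D(q,c)<D(q,c'))\,dq$. $R^q_c=\min\{R\ge0:|\{x\in T_c: maxdist(q,x)\le R\}|\ge k\}$, and similarly $R^q_{c'}$; $R^q_{max}=\min\{R^q_c,R^q_{c'}\}$; $R^q_{min}=\min_{x\in T}mindist(q,x)$. $T^q$ is the set of training objects $x_i$ with $mindist(q,x_i)\le R^q_{max}$, and $D_q(c)$ is the random variable whose outcome is the distance between $q$ and its $k$-th nearest neighbor among the objects of $T^q$ with label $c$ (similarly $D_q(c')$). In the integrals, $\Pr(\,\cdot=R)$ denotes the probability density at $R$.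
   Formalization: For an uncertain test object q, the density of D_q(c) and the tail of D_q(c') are taken given the outcome of q, and the integral over R is averaged over that outcome; with unconditional factors the formula fails, since D_q(c) and D_q(c') both depend on q. *)

theory Defs
  imports "HOL-Probability.Probability" "HOL-Library.Multiset"
begin

(* 'a is the metric space.  Probability density functions are taken with respect to a fixed
   reference measure nu on its Borel sets (Lebesgue measure lborel when 'a is a Euclidean space). *)

(* Certain q is the point q; Uncertain f S has probability density function f and SUP-region S. *)
datatype 'a uobj = Certain 'a | Uncertain "'a \<Rightarrow> real" "'a set"

primrec region :: "'a uobj \<Rightarrow> 'a set" where
  "region (Certain q) = {q}"
| "region (Uncertain f S) = S"

primrec law :: "'a::metric_space measure \<Rightarrow> 'a uobj \<Rightarrow> 'a measure" where
  "law \<nu> (Certain q) = return borel q"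
| "law \<nu> (Uncertain f S) = density \<nu> (\<lambda>v. ennreal (f v))"

(* Any bounded Borel region is admitted as SUP-region; hyperballs and hypercubes are instances. *)
definition uncertain_object :: "'a::metric_space measure \<Rightarrow> 'a uobj \<Rightarrow> bool" where
  "uncertain_object \<nu> x \<longleftrightarrow>
     (case x of
        Certain q \<Rightarrow> True
      | Uncertain f S \<Rightarrow>
          f \<in> borel_measurable \<nu> \<and> (\<forall>v. 0 \<le> f v) \<and> prob_space (law \<nu> x)) \<and>
     region x \<in> sets borel \<and> bounded (region x) \<and>
     \<P>(v in law \<nu> x. v \<notin> region x) = 0"

(* Infimum and supremum, since closed balls of a general metric space need not be compact; they
   are the minimum and the maximum whenever these exist. *)
definition mindist :: "'a::metric_space uobj \<Rightarrow> 'a uobj \<Rightarrow> real" where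
  "mindist x y = Inf {dist v w | v w. v \<in> region x \<and> w \<in> region y}"

definition maxdist :: "'a::metric_space uobj \<Rightarrow> 'a uobj \<Rightarrow> real" where
  "maxdist x y = Sup {dist v w | v w. v \<in> region x \<and> w \<in> region y}"

(* The training set is given by its size n, its objects x i and their labels lab i, for i < n.
   An outcome of it is a function w on {..<n}; the objects are independent. *)
definition outcomes :: "'a::metric_space measure \<Rightarrow> nat \<Rightarrow> (nat \<Rightarrow> 'a uobj) \<Rightarrow> (nat \<Rightarrow> 'a) measure" where
  "outcomes \<nu> n x = PiM {..<n} (\<lambda>i. law \<nu> (x i))"

(* Distance from the point v to its k-th nearest neighbour (k \<ge> 1) among the points w i, i in A.
   It is infinite if A has fewer than k elements, in accordance with the formula for the
   cumulative distribution function of D(q,c), which is then constantly 0.  This does occur: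
   the set T^q below may contain fewer than k objects of one of the two classes. *)
definition knn_dist :: "nat \<Rightarrow> nat set \<Rightarrow> 'a::metric_space \<Rightarrow> (nat \<Rightarrow> 'a) \<Rightarrow> ereal" where
  "knn_dist k A v w =
     (let ds = sorted_list_of_multiset (image_mset (\<lambda>i. dist v (w i)) (mset_set A))
      in if k \<le> length ds then ereal (ds ! (k - 1)) else \<infinity>)"

definition class_of :: "nat \<Rightarrow> (nat \<Rightarrow> 'l) \<Rightarrow> 'l \<Rightarrow> nat set" where
  "class_of n lab c = {i. i < n \<and> lab i = c}"

(* R^q_c; infinite if fewer than k training objects have label c. *)
definition R_class :: "nat \<Rightarrow> (nat \<Rightarrow> 'a::metric_space uobj) \<Rightarrow> (nat \<Rightarrow> 'l) \<Rightarrow> nat \<Rightarrow> 'a uobj \<Rightarrow> 'l \<Rightarrow> ereal" where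
  "R_class n x lab k q c =
     Inf {ereal R | R. 0 \<le> R \<and> k \<le> card {i \<in> class_of n lab c. maxdist q (x i) \<le> R}}"

definition R_max :: "nat \<Rightarrow> (nat \<Rightarrow> 'a::metric_space uobj) \<Rightarrow> (nat \<Rightarrow> 'l) \<Rightarrow> nat \<Rightarrow> 'a uobj \<Rightarrow> 'l \<Rightarrow> 'l \<Rightarrow> ereal" where
  "R_max n x lab k q c c' = min (R_class n x lab k q c) (R_class n x lab k q c')"

definition R_min :: "nat \<Rightarrow> (nat \<Rightarrow> 'a::metric_space uobj) \<Rightarrow> 'a uobj \<Rightarrow> ereal" where
  "R_min n x q = (INF i\<in>{..<n}. ereal (mindist q (x i)))"

(* The set T^q. *)
definition T_near :: "nat \<Rightarrow> (nat \<Rightarrow> 'a::metric_space uobj) \<Rightarrow> (nat \<Rightarrow> 'l) \<Rightarrow> nat \<Rightarrow> 'a uobj \<Rightarrow> 'l \<Rightarrow> 'l \<Rightarrow> nat set" where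
  "T_near n x lab k q c c' = {i. i < n \<and> ereal (mindist q (x i)) \<le> R_max n x lab k q c c'}"

(* D v c is D(q,c), and D_near q v c c' c0 is D_q(c0), when the outcome of the test object q is v
   (for a certain test object, v is q itself).  The set T^q depends on q and not on v. *)
definition D :: "nat \<Rightarrow> (nat \<Rightarrow> 'l) \<Rightarrow> nat \<Rightarrow> 'a::metric_space \<Rightarrow> 'l \<Rightarrow> (nat \<Rightarrow> 'a) \<Rightarrow> ereal" where
  "D n lab k v c = knn_dist k (class_of n lab c) v"

definition D_near :: "nat \<Rightarrow> (nat \<Rightarrow> 'a::metric_space uobj) \<Rightarrow> (nat \<Rightarrow> 'l) \<Rightarrow> nat \<Rightarrow> 'a uobj \<Rightarrow> 'a \<Rightarrow> 'l \<Rightarrow> 'l \<Rightarrow> 'l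
    \<Rightarrow> (nat \<Rightarrow> 'a) \<Rightarrow> ereal" where
  "D_near n x lab k q v c c' c0 =
     knn_dist k {i \<in> T_near n x lab k q c c'. lab i = c0} v"

(* Probability density at a real point R of a random variable X that may be infinite with positive
   probability: the Lebesgue density of the law of X restricted to the event that X is finite. *)
definition prob_density :: "'b measure \<Rightarrow> ('b \<Rightarrow> ereal) \<Rightarrow> real \<Rightarrow> real" where
  "prob_density M X R =
     enn2real (RN_deriv lborel
       (distr (restrict_space M {w \<in> space M. \<bar>X w\<bar> \<noteq> \<infinity>}) borel (\<lambda>w. real_of_ereal (X w))) R)"

(* Averages over the outcome v of the test object a quantity h v defined for certain test
   objects v; this is how probabilities are extended to uncertain test objects. *)
definition over_outcomes :: "'a::metric_space measure \<Rightarrow> 'a uobj \<Rightarrow> ('a \<Rightarrow> real) \<Rightarrow> real" where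
  "over_outcomes \<nu> q h =
     (case q of
        Certain v \<Rightarrow> h v
      | Uncertain f S \<Rightarrow> (\<integral>v. f v * h v \<partial>\<nu>))"

end

theory Submission
  imports Defs
begin

text \<open>
  Fix an outcome v of the test object. For almost all outcomes of the training set every object lies
  in its region, so if R_max is finite, some class has k objects within distance R_max of v; hence
  the smaller of the two k-th neighbour distances is always at most R_max. The objects outside T^q are farther than
  R_max, so discarding them changes neither a k-th neighbour distance that is at most R_max nor
  which class wins. Thus D(q,c) < D(q,c') holds exactly if D_q(c) \<le> R_max and D_q(c) < D_q(c').
  Since D_q(c) is at least R_min, has no atoms on the real line and is independent of D_q(c'), the
  probability of this event is the integral of the density of D_q(c) times the tail of D_q(c').

  For an uncertain test object, v lies in its region only almost surely. As \<nu> need not be complete,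
  almost everywhere equality of the integrands is not enough: both must be measurable in v. They are lower semicontinuous:
  the k-th neighbour distance is 1-Lipschitz in v and the events are given by strict inequalities.
\<close>

subsection \<open>Order statistics of distances\<close>

text \<open>In a sorted list the entries at most \<open>r\<close> form an initial segment, so the
  zero-based position \<open>j\<close> lies in it exactly if the segment is longer than
  \<open>j\<close>.\<close>

lemma sorted_nth_le_iff_length_filter:
  fixes xs :: "'a::linorder list"
  assumes "sorted xs" and "j < length xs"
  shows "xs ! j \<le> r \<longleftrightarrow> j < length (filter (\<lambda>y. y \<le> r) xs)"
proof
  assume le: "xs ! j \<le> r"
  have "y \<le> r" if "y \<in> set (take (Suc j) xs)" for y
  proof -
    from that obtain i where "i < Suc j" "i < length xs" "y = xs ! i"
      unfolding in_set_conv_nth by force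
    then have "y \<le> xs ! j"
      using assms sorted_nth_mono[of xs i j] by simp
    then show ?thesis using le by simp
  qed
  then have "filter (\<lambda>y. y \<le> r) (take (Suc j) xs) = take (Suc j) xs"
    by (simp add: filter_id_conv)
  then have "length (filter (\<lambda>y. y \<le> r) (take (Suc j) xs)) = Suc j"
    using assms(2) by simp
  moreover have "length (filter (\<lambda>y. y \<le> r) xs)
      = length (filter (\<lambda>y. y \<le> r) (take (Suc j) xs)) + length (filter (\<lambda>y. y \<le> r) (drop (Suc j) xs))"
    by (metis append_take_drop_id filter_append length_append)
  ultimately show "j < length (filter (\<lambda>y. y \<le> r) xs)"
    by simp
next
  assume j: "j < length (filter (\<lambda>y. y \<le> r) xs)"
  show "xs ! j \<le> r"
  proof (rule ccontr)
    assume gt: "\<not> xs ! j \<le> r"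
    have "\<not> y \<le> r" if "y \<in> set (drop j xs)" for y
    proof -
      from that obtain i where "i < length (drop j xs)" "y = drop j xs ! i"
        unfolding in_set_conv_nth by force
      then have "xs ! j \<le> y"
        using assms sorted_nth_mono[of xs j "j + i"] by auto
      then show ?thesis using gt by simp
    qed
    then have "filter (\<lambda>y. y \<le> r) (drop j xs) = []"
      by (simp add: filter_empty_conv)
    then have "filter (\<lambda>y. y \<le> r) xs = filter (\<lambda>y. y \<le> r) (take j xs)"
      by (metis append_Nil2 append_take_drop_id filter_append)
    moreover have "length (filter (\<lambda>y. y \<le> r) (take j xs)) \<le> j"
      by (metis length_filter_le length_take min.absorb_iff2 min.bounded_iff order_refl)
    ultimately show False using j by simp
  qed
qed

text \<open>Replaces the sorted list by a count of the points within radius \<open>r\<close>. If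
  \<open>A\<close> has fewer than \<open>k\<close> points, the distance is infinite and the count
  too small, so both sides fail.\<close>

lemma knn_dist_le_iff:
  assumes "finite A" and "k \<ge> 1"
  shows "knn_dist k A v w \<le> ereal r \<longleftrightarrow> k \<le> card {i \<in> A. dist v (w i) \<le> r}"
proof -
  define ds where "ds = sorted_list_of_multiset (image_mset (\<lambda>i. dist v (w i)) (mset_set A))"
  have mds: "mset ds = image_mset (\<lambda>i. dist v (w i)) (mset_set A)"
    by (simp add: ds_def)
  have len: "length ds = card A"
    by (metis mds size_image_mset size_mset size_mset_set)
  have "length (filter (\<lambda>y. y \<le> r) ds) = size (filter_mset (\<lambda>y. y \<le> r) (mset ds))"
    by (metis mset_filter size_mset)
  also have "\<dots> = card {i \<in> A. dist v (w i) \<le> r}"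
    using assms(1) by (simp add: mds filter_mset_image_mset filter_mset_mset_set)
  finally have cnt: "length (filter (\<lambda>y. y \<le> r) ds) = card {i \<in> A. dist v (w i) \<le> r}" .
  show ?thesis
  proof (cases "k \<le> length ds")
    case True
    have "sorted ds" by (simp add: ds_def)
    then have "ds ! (k - 1) \<le> r \<longleftrightarrow> k - 1 < card {i \<in> A. dist v (w i) \<le> r}"
      using True assms(2) by (subst sorted_nth_le_iff_length_filter) (auto simp: cnt)
    then show ?thesis
      using True assms(2) by (auto simp: knn_dist_def ds_def[symmetric] Let_def)
  next
    case False
    moreover have "card {i \<in> A. dist v (w i) \<le> r} \<le> card A"
      using assms(1) by (intro card_mono) auto
    ultimately show ?thesis
      using len by (auto simp: knn_dist_def ds_def[symmetric] Let_def)
  qed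
qed

lemma knn_dist_attained:
  assumes "finite A" and "k \<ge> 1" and "k \<le> card A"
  obtains i where "i \<in> A" and "knn_dist k A v w = ereal (dist v (w i))"
proof -
  define ds where "ds = sorted_list_of_multiset (image_mset (\<lambda>i. dist v (w i)) (mset_set A))"
  have mds: "mset ds = image_mset (\<lambda>i. dist v (w i)) (mset_set A)"
    by (simp add: ds_def)
  have len: "length ds = card A"
    by (metis mds size_image_mset size_mset size_mset_set)
  have "ds ! (k - 1) \<in> set ds"
    using len assms by (intro nth_mem) simp
  also have "set ds = (\<lambda>i. dist v (w i)) ` A"
    using assms(1) by (simp add: ds_def)
  finally obtain i where "i \<in> A" "ds ! (k - 1) = dist v (w i)" by blast
  moreover have "knn_dist k A v w = ereal (ds ! (k - 1))"
    using len assms by (simp add: knn_dist_def ds_def[symmetric] Let_def)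
  ultimately show ?thesis using that by simp
qed

lemma knn_dist_infinite:
  assumes "card A < k"
  shows "knn_dist k A v w = \<infinity>"
  using assms by (simp add: knn_dist_def Let_def flip: size_mset)

text \<open>Used to exclude \<open>-\<infinity>\<close> and to pass almost sure properties of the
  single distances on to the finite values.\<close>

lemma knn_dist_cases:
  assumes "finite A" and "k \<ge> 1"
  obtains "knn_dist k A v w = \<infinity>"
  | i where "i \<in> A" and "knn_dist k A v w = ereal (dist v (w i))"
  using knn_dist_attained[OF assms] knn_dist_infinite[of A k v w] by (meson not_le)

lemma knn_dist_antimono:
  assumes "finite B" and "A \<subseteq> B" and "k \<ge> 1"
  shows "knn_dist k B v w \<le> knn_dist k A v w"
proof -
  have A: "finite A" using assms finite_subset by blast
  show ?thesis
  proof (cases rule: knn_dist_cases[OF A assms(3), of v w])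
    case (2 i)
    have "k \<le> card {i' \<in> A. dist v (w i') \<le> dist v (w i)}"
      using 2 knn_dist_le_iff[OF A assms(3), of v w "dist v (w i)"] by simp
    also have "\<dots> \<le> card {i' \<in> B. dist v (w i') \<le> dist v (w i)}"
      using assms by (intro card_mono) auto
    finally show ?thesis
      using 2 knn_dist_le_iff[OF assms(1,3)] by metis
  qed simp
qed

text \<open>By the triangle inequality, \<open>k\<close> points within \<open>r\<close> of
  \<open>v\<close> lie within \<open>r + dist v v'\<close> of \<open>v'\<close>.\<close>

lemma knn_dist_le_add_dist:
  assumes "finite A" and "k \<ge> 1"
  shows "knn_dist k A v' w \<le> knn_dist k A v w + ereal (dist v v')"
proof (cases rule: knn_dist_cases[OF assms, of v w])
  case (2 i)
  have "k \<le> card {i' \<in> A. dist v (w i') \<le> dist v (w i)}"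
    using 2 knn_dist_le_iff[OF assms, of v w "dist v (w i)"] by simp
  also have "\<dots> \<le> card {i' \<in> A. dist v' (w i') \<le> dist v (w i) + dist v v'}"
  proof (intro card_mono subsetI)
    fix j assume "j \<in> {i' \<in> A. dist v (w i') \<le> dist v (w i)}"
    then show "j \<in> {i' \<in> A. dist v' (w i') \<le> dist v (w i) + dist v v'}"
      using dist_triangle[of v' "w j" v] by (auto simp: dist_commute)
  qed (use assms in auto)
  finally have "knn_dist k A v' w \<le> ereal (dist v (w i) + dist v v')"
    using knn_dist_le_iff[OF assms] by metis
  then show ?thesis using 2 by simp
qed simp

text \<open>Whether the value is infinite depends on \<open>card A\<close> and not on
  \<open>v\<close>, so the function is either real-valued and 1-Lipschitz or constantly
  infinite.\<close>

lemma continuous_on_knn_dist: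
  assumes "finite A" and "k \<ge> 1"
  shows "continuous_on UNIV (\<lambda>v. knn_dist k A v w)"
proof (cases "k \<le> card A")
  case True
  define g where "g v = real_of_ereal (knn_dist k A v w)" for v
  have g: "knn_dist k A v w = ereal (g v)" for v
    using knn_dist_attained[OF assms True, of v w] by (metis g_def real_of_ereal.simps(1))
  have le: "g v' \<le> g v + dist v v'" for v v'
    using knn_dist_le_add_dist[OF assms, of v' w v] by (simp add: g)
  have "dist (g v') (g v) \<le> dist v' v" for v v'
    using le[of v v'] le[of v' v] by (auto simp: dist_real_def dist_commute)
  then have "continuous_on UNIV g"
    unfolding continuous_on_iff by (meson order_le_less_trans)
  then show ?thesis by (simp add: g continuous_on_ereal)
next
  case False
  then show ?thesis by (simp add: knn_dist_infinite)
qed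

lemma borel_measurable_knn_dist:
  assumes "finite A" and "k \<ge> 1"
    and meas: "\<And>i. i \<in> A \<Longrightarrow> (\<lambda>w. dist v (X w i)) \<in> borel_measurable M"
  shows "(\<lambda>w. knn_dist k A v (X w)) \<in> borel_measurable M"
proof (rule borel_measurableI_le)
  fix y :: ereal
  show "{w \<in> space M. knn_dist k A v (X w) \<le> y} \<in> sets M"
  proof (cases y)
    case (real r)
    \<comment> \<open>The count becomes a finite sum of indicators, whose measurability follows from
      that of the single distances.\<close>
    have "{w \<in> space M. knn_dist k A v (X w) \<le> y}
        = {w \<in> space M. real k \<le> (\<Sum>i\<in>A. indicat_real {..r} (dist v (X w i)))}"
      using assms(1)
      by (simp add: real knn_dist_le_iff[OF assms(1,2)] indicator_def sum.If_cases Int_def)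
    also have "\<dots> \<in> sets M"
      using meas by measurable
    finally show ?thesis .
  next
    case MInf
    have "knn_dist k A v (X w) \<noteq> -\<infinity>" for w
      by (cases rule: knn_dist_cases[OF assms(1,2), of v "X w"]) simp_all
    then show ?thesis by (simp add: MInf)
  qed simp
qed

subsection \<open>Events depending on a parameter, and densities\<close>

text \<open>Open sections make the indicator of \<open>E v\<close> at \<open>w\<close> lower
  semicontinuous in \<open>v\<close>, and Fatou's lemma carries this over to the measure. This takes
  the place of joint measurability in \<open>v\<close> and \<open>w\<close>, which can fail if the
  metric space is not separable.\<close>

lemma (in finite_measure) borel_measurable_measure_open_sections:
  fixes E :: "'b::metric_space \<Rightarrow> 'a set"
  assumes E: "\<And>v. E v \<in> sets M"
    and sections: "\<And>w. w \<in> space M \<Longrightarrow> open {v. w \<in> E v}"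
  shows "(\<lambda>v. measure M (E v)) \<in> borel_measurable borel"
proof (rule borel_measurableI_greater)
  fix y :: real
  have "closed {v. measure M (E v) \<le> y}"
    unfolding closed_sequential_limits
  proof (intro allI impI, elim conjE)
    fix s l assume le: "\<forall>n. s n \<in> {v. measure M (E v) \<le> y}" and lim: "s \<longlonglongrightarrow> l"
    have "emeasure M (E l) = (\<integral>\<^sup>+ w. indicator (E l) w \<partial>M)"
      using E by simp
    also have "\<dots> \<le> (\<integral>\<^sup>+ w. liminf (\<lambda>n. indicator (E (s n)) w) \<partial>M)"
    proof (intro nn_integral_mono)
      fix w assume w: "w \<in> space M"
      show "indicator (E l) w \<le> (liminf (\<lambda>n. indicator (E (s n)) w) :: ennreal)"
      proof (cases "w \<in> E l")
        case True
        then have "\<forall>\<^sub>F n in sequentially. s n \<in> {v. w \<in> E v}"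
          using topological_tendstoD[OF lim sections[OF w]] by simp
        then have "\<forall>\<^sub>F n in sequentially. (1::ennreal) \<le> indicator (E (s n)) w"
          by eventually_elim simp
        then have "(1::ennreal) \<le> liminf (\<lambda>n. indicator (E (s n)) w)"
          by (rule Liminf_bounded)
        then show ?thesis using True by simp
      qed simp
    qed
    also have "\<dots> \<le> liminf (\<lambda>n. \<integral>\<^sup>+ w. indicator (E (s n)) w \<partial>M)"
      using E by (intro nn_integral_liminf) simp
    also have "\<dots> \<le> liminf (\<lambda>n. ennreal y)"
      using le E by (intro Liminf_mono always_eventually) (simp add: emeasure_eq_measure ennreal_leI)
    finally have "ennreal (measure M (E l)) \<le> ennreal y"
      by (simp add: emeasure_eq_measure Liminf_const)
    \<comment> \<open>\<open>ennreal\<close> sends negative reals to 0, so the sign of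
      \<open>y\<close> is needed to return to a real inequality.\<close>
    moreover have "0 \<le> y"
      using le measure_nonneg order_trans by blast
    ultimately show "l \<in> {v. measure M (E v) \<le> y}" by simp
  qed
  then have "open (- {v. measure M (E v) \<le> y})" by (rule open_Compl)
  moreover have "- {v. measure M (E v) \<le> y} = {v \<in> space borel. y < measure M (E v)}"
    by auto
  ultimately show "{v \<in> space borel. y < measure M (E v)} \<in> sets borel" by simp
qed

text \<open>Only the finite part of \<open>X\<close> has a density, which suffices because the
  strict bounds \<open>a\<close> and \<open>b\<close> force \<open>X w\<close> to be finite.
  Independence turns the law of the pair into a product, and the tail of \<open>Y\<close> is
  integrated against the law of \<open>X\<close>.\<close>

lemma (in prob_space) prob_density_integral:
  fixes X Y :: "'a \<Rightarrow> ereal"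
  assumes indep: "indep_var borel X borel Y"
    and abs_cont: "\<And>N. N \<in> null_sets lborel \<Longrightarrow> AE w in M. X w \<notin> ereal ` N"
    and "a \<le> b"
  shows "(LBINT R=a..b. prob_density M X R * \<P>(w in M. Y w > ereal R))
       = \<P>(w in M. a < X w \<and> X w < b \<and> X w < Y w)"
proof -
  have X[measurable]: "X \<in> borel_measurable M" and Y[measurable]: "Y \<in> borel_measurable M"
    using indep indep_var_rv1 indep_var_rv2 by blast+
  \<comment> \<open>\<open>real_of_ereal\<close> sends infinite values to 0; restricting to
    \<open>F\<close> keeps their mass from becoming an atom at 0.\<close>
  define F where "F = {w \<in> space M. \<bar>X w\<bar> \<noteq> \<infinity>}"
  have F[measurable]: "F \<in> sets M" unfolding F_def by measurable
  define L where "L = distr (restrict_space M F) borel (\<lambda>w. real_of_ereal (X w))"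
  have Xr[measurable]: "(\<lambda>w. real_of_ereal (X w)) \<in> borel_measurable (restrict_space M F)"
    by (intro measurable_restrict_space1) measurable
  have setsL: "sets L = sets lborel" by (simp add: L_def)
  have emL: "emeasure L A = emeasure M {w \<in> F. real_of_ereal (X w) \<in> A}" if "A \<in> sets borel" for A
  proof -
    have "emeasure L A = emeasure (restrict_space M F)
        ((\<lambda>w. real_of_ereal (X w)) -` A \<inter> space (restrict_space M F))"
      unfolding L_def using that by (intro emeasure_distr) auto
    also have "\<dots> = emeasure M ((\<lambda>w. real_of_ereal (X w)) -` A \<inter> space (restrict_space M F))"
      by (intro emeasure_restrict_space) (use F in \<open>auto simp: space_restrict_space\<close>)
    also have "(\<lambda>w. real_of_ereal (X w)) -` A \<inter> space (restrict_space M F) = {w \<in> F. real_of_ereal (X w) \<in> A}"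
      using sets.sets_into_space[OF F] by (auto simp: space_restrict_space)
    finally show ?thesis .
  qed
  have "finite_measure L"
  proof (rule finite_measureI)
    have "space L = UNIV" by (simp add: L_def)
    then show "emeasure L (space L) \<noteq> \<infinity>" by (simp add: emL)
  qed
  have ac: "absolutely_continuous lborel L"
    unfolding absolutely_continuous_def
  proof
    fix N :: "real set" assume N: "N \<in> null_sets lborel"
    then have Nb[measurable]: "N \<in> sets borel" by auto
    have "AE w in M. \<not> (w \<in> F \<and> real_of_ereal (X w) \<in> N)"
      using abs_cont[OF N]
    proof eventually_elim
      case (elim w)
      then show ?case by (cases "X w") (auto simp: F_def)
    qed
    then have "emeasure M {w \<in> space M. w \<in> F \<and> real_of_ereal (X w) \<in> N} = 0"
      by (subst (asm) AE_iff_measurable[OF _ refl]) auto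
    moreover have "{w \<in> space M. w \<in> F \<and> real_of_ereal (X w) \<in> N} = {w \<in> F. real_of_ereal (X w) \<in> N}"
      by (auto simp: F_def)
    ultimately show "N \<in> null_sets L"
      using Nb by (auto simp: null_sets_def emL setsL)
  qed
  \<comment> \<open>The derivative of a finite measure is finite almost everywhere, so
    \<open>enn2real\<close> in \<open>prob_density\<close> loses nothing.\<close>
  obtain g where g: "g \<in> borel_measurable lborel" "AE r in lborel. RN_deriv lborel L r = ennreal (g r)"
    using sigma_finite_measure.real_RN_deriv[OF sigma_finite_lborel \<open>finite_measure L\<close> ac setsL] by metis
  have dens: "AE r in lborel. RN_deriv lborel L r = ennreal (prob_density M X r)"
    using g(2) by eventually_elim (auto simp: prob_density_def L_def F_def)
  have dens_meas[measurable]: "prob_density M X \<in> borel_measurable borel"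
    unfolding prob_density_def L_def[unfolded F_def, symmetric]
    using borel_measurable_RN_deriv[of lborel L] by simp
  define p where "p r = emeasure (distr M borel Y) {y. ereal r < y}" for r
  interpret Y: prob_space "distr M borel Y" by (rule prob_space_distr) simp
  \<comment> \<open>The tail is the measure of the sections of an open set of pairs, hence
    measurable in the lower bound.\<close>
  have p_meas': "(\<lambda>x::ereal. emeasure (distr M borel Y) {y. x < y}) \<in> borel_measurable borel"
  proof -
    have "{z::ereal \<times> ereal. fst z < snd z} \<in> sets (borel \<Otimes>\<^sub>M borel)"
      unfolding borel_prod
      by (intro borel_open open_Collect_less continuous_intros)
    then have "(\<lambda>x. emeasure (distr M borel Y) (Pair x -` {z. fst z < snd z})) \<in> borel_measurable borel"
      by (intro Y.measurable_emeasure_Pair) simp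
    then show ?thesis by simp
  qed
  have p_meas[measurable]: "p \<in> borel_measurable borel"
    unfolding p_def using measurable_compose[OF _ p_meas', of ereal] by simp
  have p: "p r = ennreal (\<P>(w in M. Y w > ereal r))" for r
    unfolding p_def
    by (subst emeasure_distr) (auto simp: emeasure_eq_measure vimage_def Int_def conj_commute intro!: arg_cong[where f=prob])
  have P_meas[measurable]: "(\<lambda>r. \<P>(w in M. Y w > ereal r)) \<in> borel_measurable borel"
  proof -
    have "(\<lambda>r. enn2real (p r)) \<in> borel_measurable borel" by measurable
    then show ?thesis by (simp add: p)
  qed
  let ?I = "\<lambda>r. indicator (einterval a b) r :: ennreal"
  let ?B = "{z::ereal \<times> ereal. a < fst z \<and> fst z < b \<and> fst z < snd z}"
  have B: "?B \<in> sets (borel \<Otimes>\<^sub>M borel)"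
    unfolding borel_prod
    by (intro borel_open open_Collect_conj open_Collect_less continuous_intros)
  have "emeasure M {w \<in> space M. a < X w \<and> X w < b \<and> X w < Y w}
      = emeasure (distr M (borel \<Otimes>\<^sub>M borel) (\<lambda>w. (X w, Y w))) ?B"
    using B by (subst emeasure_distr) (auto simp: vimage_def Int_def conj_ac)
  also have "\<dots> = emeasure (distr M borel X \<Otimes>\<^sub>M distr M borel Y) ?B"
    using indep unfolding indep_var_distribution_eq by simp
  also have "\<dots> = (\<integral>\<^sup>+ x. emeasure (distr M borel Y) (Pair x -` ?B) \<partial>distr M borel X)"
    using B by (intro Y.emeasure_pair_measure_alt) simp
  also have "\<dots> = (\<integral>\<^sup>+ x. indicator {a<..<b} x * emeasure (distr M borel Y) {y. x < y} \<partial>distr M borel X)"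
    by (intro nn_integral_cong) (auto split: split_indicator)
  also have "\<dots> = (\<integral>\<^sup>+ w. indicator {a<..<b} (X w) * emeasure (distr M borel Y) {y. X w < y} \<partial>M)"
    using p_meas' by (intro nn_integral_distr) auto
  also have "\<dots> = (\<integral>\<^sup>+ w. (?I (real_of_ereal (X w)) * p (real_of_ereal (X w))) * indicator F w \<partial>M)"
  proof (intro nn_integral_cong)
    fix w assume "w \<in> space M"
    then show "indicator {a<..<b} (X w) * emeasure (distr M borel Y) {y. X w < y}
       = (?I (real_of_ereal (X w)) * p (real_of_ereal (X w))) * indicator F w"
      by (cases "X w") (auto simp: F_def p_def einterval_def split: split_indicator)
  qed
  also have "\<dots> = (\<integral>\<^sup>+ w. ?I (real_of_ereal (X w)) * p (real_of_ereal (X w)) \<partial>restrict_space M F)"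
    by (intro nn_integral_restrict_space[symmetric]) auto
  also have "\<dots> = (\<integral>\<^sup>+ r. ?I r * p r \<partial>L)"
    unfolding L_def by (intro nn_integral_distr[symmetric]) auto
  also have "\<dots> = (\<integral>\<^sup>+ r. RN_deriv lborel L r * (?I r * p r) \<partial>lborel)"
    by (intro sigma_finite_measure.RN_deriv_nn_integral[OF sigma_finite_lborel ac setsL]) auto
  also have "\<dots> = (\<integral>\<^sup>+ r. ennreal (indicator (einterval a b) r *\<^sub>R
        (prob_density M X r * \<P>(w in M. Y w > ereal r))) \<partial>lborel)"
    using dens by (intro nn_integral_cong_AE, eventually_elim)
      (auto simp: p ennreal_mult prob_density_def split: split_indicator)
  finally have "enn2real (emeasure M {w \<in> space M. a < X w \<and> X w < b \<and> X w < Y w})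
     = (\<integral> r. indicator (einterval a b) r *\<^sub>R (prob_density M X r * \<P>(w in M. Y w > ereal r)) \<partial>lborel)"
    by (subst integral_eq_nn_integral) (auto simp: prob_density_def[of M X])
  \<comment> \<open>With \<open>a \<le> b\<close> the interval integral is the one over the open
    interval \<open>einterval a b\<close>; reversed limits would change its sign.\<close>
  then show ?thesis
    using \<open>a \<le> b\<close> by (simp add: interval_lebesgue_integral_def set_lebesgue_integral_def measure_def)
qed


subsection \<open>Independent objects\<close>

lemma knn_dist_cong:
  assumes "\<And>i. i \<in> A \<Longrightarrow> w i = w' i"
  shows "knn_dist k A v w = knn_dist k A v w'"
proof (cases "finite A")
  case True
  then have "image_mset (\<lambda>i. dist v (w i)) (mset_set A) = image_mset (\<lambda>i. dist v (w' i)) (mset_set A)"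
    using assms by (intro image_mset_cong) auto
  then show ?thesis by (simp add: knn_dist_def)
qed (simp add: knn_dist_def)

text \<open>Restriction to \<open>I\<close> is the identity on the product space, so the joint law
  of the coordinates is the product of their laws; for nonempty \<open>I\<close> this characterises
  independence.\<close>

lemma indep_vars_PiM_components:
  assumes "\<And>i. i \<in> I \<Longrightarrow> prob_space (M i)"
  shows "prob_space.indep_vars (PiM I M) M (\<lambda>i w. w i) I"
proof -
  interpret prob_space "PiM I M"
    by (intro prob_space_PiM assms)
  show ?thesis
  proof (cases "I = {}")
    case True
    then show ?thesis unfolding indep_vars_def indep_sets_def by simp
  next
    case False
    have "distr (PiM I M) (PiM I M) (\<lambda>w. \<lambda>i\<in>I. w i) = distr (PiM I M) (PiM I M) (\<lambda>w. w)"
      by (intro distr_cong) (auto simp: space_PiM PiE_iff extensional_restrict)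
    also have "\<dots> = PiM I (\<lambda>i. distr (PiM I M) (M i) (\<lambda>w. w i))"
      by (simp add: distr_PiM_component assms cong: PiM_cong)
    finally show ?thesis
      using False by (subst indep_vars_iff_distr_eq_PiM') auto
  qed
qed

text \<open>Each distance reads only the coordinates of its own index set, so it factors through a
  restriction, and restrictions to disjoint sets are independent.\<close>

lemma indep_var_knn_dist:
  assumes M: "\<And>i. i \<in> I \<Longrightarrow> prob_space (M i)"
    and dist: "\<And>i. i \<in> I \<Longrightarrow> dist v \<in> borel_measurable (M i)"
    and "finite A" "finite B" "A \<inter> B = {}" "A \<subseteq> I" "B \<subseteq> I" "k \<ge> 1"
  shows "prob_space.indep_var (PiM I M) borel (knn_dist k A v) borel (knn_dist k B v)"
proof -
  interpret prob_space "PiM I M"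
    by (intro prob_space_PiM M)
  have meas: "knn_dist k C v \<in> borel_measurable (PiM C M)" if "finite C" "C \<subseteq> I" for C
  proof -
    have "(\<lambda>w. dist v (w i)) \<in> borel_measurable (PiM C M)" if "i \<in> C" for i
    proof -
      have "dist v \<in> borel_measurable (M i)" using that \<open>C \<subseteq> I\<close> dist by blast
      with measurable_component_singleton[OF that, of M] show ?thesis by (rule measurable_compose)
    qed
    then show ?thesis
      using that assms(8) by (intro borel_measurable_knn_dist) auto
  qed
  have "indep_var borel (knn_dist k A v \<circ> (\<lambda>w. \<lambda>i\<in>A. w i)) borel (knn_dist k B v \<circ> (\<lambda>w. \<lambda>i\<in>B. w i))"
    by (rule indep_var_compose[OF indep_var_restrict[OF indep_vars_PiM_components[OF M]] meas meas])
      (use assms in auto)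
  moreover have "knn_dist k C v \<circ> (\<lambda>w. \<lambda>i\<in>C. w i) = knn_dist k C v" for C
    by (rule ext) (auto intro: knn_dist_cong)
  ultimately show ?thesis by simp
qed

subsection \<open>Pruning\<close>

lemma mindist_le_dist:
  assumes "v \<in> region x" and "u \<in> region y"
  shows "mindist x y \<le> dist v u"
  unfolding mindist_def using assms
  by (intro cInf_lower bdd_belowI[where m = 0]) auto

text \<open>Boundedness of both regions bounds all distances by the triangle inequality through
  \<open>v\<close>, which makes the real supremum a genuine upper bound.\<close>

lemma dist_le_maxdist:
  assumes "v \<in> region x" and "u \<in> region y" and "bounded (region x)" and "bounded (region y)"
  shows "dist v u \<le> maxdist x y"
proof -
  obtain d where d: "\<forall>a\<in>region x. dist v a \<le> d"
    using bounded_any_center[THEN iffD1, OF assms(3)] by blast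
  obtain e where e: "\<forall>b\<in>region y. dist v b \<le> e"
    using bounded_any_center[THEN iffD1, OF assms(4)] by blast
  have "dist a b \<le> d + e" if "a \<in> region x" "b \<in> region y" for a b
    using that d e dist_triangle3[of a b v] by fastforce
  then show ?thesis
    unfolding maxdist_def using assms(1,2)
    by (intro cSup_upper bdd_aboveI[where M = "d + e"]) auto
qed

section \<open>Laws and regions of uncertain objects\<close>

lemma region_nonempty:
  assumes "uncertain_object \<nu> y"
  shows "region y \<noteq> {}"
proof (cases y)
  case (Uncertain f S)
  then have "prob_space (law \<nu> y)" "\<P>(v in law \<nu> y. v \<notin> region y) = 0"
    using assms by (auto simp: uncertain_object_def)
  \<comment> \<open>The complement of an empty region would have probability 1.\<close>
  then show ?thesis
    using prob_space.prob_space[of "law \<nu> y"] by auto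
qed simp

lemma prob_space_law:
  assumes "uncertain_object \<nu> y"
  shows "prob_space (law \<nu> y)"
  using assms by (cases y) (auto simp: uncertain_object_def intro!: prob_space_return)

lemma sets_law:
  assumes "sets \<nu> = sets borel"
  shows "sets (law \<nu> y) = sets borel"
  using assms by (cases y) auto

lemma AE_in_region:
  assumes "sets \<nu> = sets borel" and "uncertain_object \<nu> y"
  shows "AE v in law \<nu> y. v \<in> region y"
proof -
  interpret prob_space "law \<nu> y" by (rule prob_space_law) fact
  note [measurable_cong] = sets_law[OF assms(1), of y]
  have [measurable]: "region y \<in> sets borel"
    using assms(2) by (simp add: uncertain_object_def)
  have "{v \<in> space (law \<nu> y). v \<notin> region y} \<in> sets (law \<nu> y)"
    by measurable
  moreover have "\<P>(v in law \<nu> y. v \<notin> region y) = 0"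
    using assms(2) by (simp add: uncertain_object_def)
  ultimately show ?thesis
    by (subst AE_iff_measurable[OF _ refl]) (auto simp: emeasure_eq_measure)
qed

section \<open>Pruning for a fixed outcome with every object in its region\<close>

context
  fixes n k :: nat and x :: "nat \<Rightarrow> 'a::metric_space uobj" and lab :: "nat \<Rightarrow> 'l"
    and c c' :: 'l and q :: "'a uobj" and v :: 'a and w :: "nat \<Rightarrow> 'a"
  assumes k: "k \<ge> 1"
    and bounded_q: "bounded (region q)"
    and bounded_x: "\<And>i. i < n \<Longrightarrow> bounded (region (x i))"
    and v: "v \<in> region q"
    and w: "\<And>i. i < n \<Longrightarrow> w i \<in> region (x i)"
begin

text \<open>Objects with \<open>maxdist\<close> at most \<open>R\<close> lie within \<open>R\<close>
  of \<open>v\<close> in this outcome. If no admissible \<open>R\<close> exists, the infimum is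
  infinite and the bound trivial.\<close>

lemma D_le_R_class: "D n lab k v c0 w \<le> R_class n x lab k q c0"
  unfolding R_class_def
proof (intro Inf_greatest, elim CollectE exE conjE)
  fix y R assume y: "y = ereal R" and R: "k \<le> card {i \<in> class_of n lab c0. maxdist q (x i) \<le> R}"
  have "card {i \<in> class_of n lab c0. maxdist q (x i) \<le> R}
      \<le> card {i \<in> class_of n lab c0. dist v (w i) \<le> R}"
  proof (intro card_mono subsetI)
    fix i assume "i \<in> {i \<in> class_of n lab c0. maxdist q (x i) \<le> R}"
    then show "i \<in> {i \<in> class_of n lab c0. dist v (w i) \<le> R}"
      using dist_le_maxdist[OF v w bounded_q bounded_x, of i] by (auto simp: class_of_def)
  qed (simp add: class_of_def)
  then show "D n lab k v c0 w \<le> y"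
    using R k by (simp add: y D_def knn_dist_le_iff class_of_def)
qed

lemma min_D_le_R_max: "min (D n lab k v c w) (D n lab k v c' w) \<le> R_max n x lab k q c c'"
  unfolding R_max_def by (intro min.mono D_le_R_class)

lemma R_min_le_knn_dist:
  assumes "A \<subseteq> {..<n}"
  shows "R_min n x q \<le> knn_dist k A v w"
proof -
  have "finite A" using assms finite_subset by blast
  show ?thesis
  proof (cases rule: knn_dist_cases[OF \<open>finite A\<close> k, of v w])
    case (2 i)
    have "i < n" using 2 assms by auto
    then have "R_min n x q \<le> ereal (mindist q (x i))"
      unfolding R_min_def by (intro INF_lower) simp
    also have "\<dots> \<le> knn_dist k A v w"
      using 2 mindist_le_dist[OF v w[OF \<open>i < n\<close>]] by simp
    finally show ?thesis .
  qed simp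
qed

text \<open>The smaller k-th neighbour distance of any one outcome lies between the two limits. This
  orients the interval of integration.\<close>

lemma R_min_le_R_max: "R_min n x q \<le> R_max n x lab k q c c'"
proof -
  have "R_min n x q \<le> min (D n lab k v c w) (D n lab k v c' w)"
    by (auto simp: D_def class_of_def intro!: R_min_le_knn_dist)
  then show ?thesis using min_D_le_R_max by (rule order_trans)
qed

lemma D_le_D_near: "D n lab k v c0 w \<le> D_near n x lab k q v c c' c0 w"
  unfolding D_def D_near_def
  by (intro knn_dist_antimono k) (auto simp: class_of_def T_near_def)

text \<open>An object within \<open>r\<close> of \<open>v\<close>, with \<open>r\<close> at most
  \<open>R_max\<close>, has \<open>mindist\<close> at most \<open>R_max\<close> and so belongs to
  \<open>T_near\<close>. Pruning therefore keeps the count at radius \<open>r\<close>.\<close>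

lemma D_near_eq_D:
  assumes "D n lab k v c0 w \<le> R_max n x lab k q c c'"
  shows "D_near n x lab k q v c c' c0 w = D n lab k v c0 w"
proof (rule antisym[OF _ D_le_D_near])
  let ?A = "class_of n lab c0" and ?B = "{i \<in> T_near n x lab k q c c'. lab i = c0}"
  have fin: "finite ?A" "finite ?B" by (auto simp: class_of_def T_near_def)
  show "D_near n x lab k q v c c' c0 w \<le> D n lab k v c0 w"
  proof (cases "D n lab k v c0 w")
    case (real r)
    have "k \<le> card {i \<in> ?A. dist v (w i) \<le> r}"
      using real knn_dist_le_iff[OF fin(1) k, of v w r] by (simp add: D_def)
    also have "\<dots> \<le> card {i \<in> ?B. dist v (w i) \<le> r}"
    proof (intro card_mono[OF finite_subset[OF _ fin(2)]] subsetI)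
      fix i assume "i \<in> {i \<in> ?B. dist v (w i) \<le> r}"
      then show "i \<in> ?B" by simp
    next
      fix i assume i: "i \<in> {i \<in> ?A. dist v (w i) \<le> r}"
      then have "ereal (mindist q (x i)) \<le> ereal r"
        using mindist_le_dist[OF v w, of i] by (auto simp: class_of_def)
      also have "\<dots> \<le> R_max n x lab k q c c'"
        using assms real by simp
      finally show "i \<in> {i \<in> ?B. dist v (w i) \<le> r}"
        using i by (auto simp: T_near_def class_of_def)
    qed
    finally have "knn_dist k ?B v w \<le> ereal r"
      using knn_dist_le_iff[OF fin(2) k] by blast
    then show ?thesis by (simp add: real D_near_def)
  next
    case MInf
    then show ?thesis
      by (cases rule: knn_dist_cases[OF fin(1) k, of v w]) (simp_all add: D_def)
  qed simp
qed

text \<open>The smaller distance is at most \<open>R_max\<close> and survives pruning, while the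
  other can only grow. The bound by \<open>R_max\<close> is carried along to become the upper limit
  of integration.\<close>

lemma D_less_iff_D_near_less:
  "D n lab k v c w < D n lab k v c' w \<longleftrightarrow>
     D_near n x lab k q v c c' c w \<le> R_max n x lab k q c c' \<and>
     D_near n x lab k q v c c' c w < D_near n x lab k q v c c' c' w" (is "?L \<longleftrightarrow> ?R")
proof
  assume ?L
  then have "D n lab k v c w \<le> R_max n x lab k q c c'"
    using min_D_le_R_max by (simp add: min_def split: if_splits)
  then show ?R
    using D_near_eq_D[of c] D_le_D_near[of c'] \<open>?L\<close> by auto
next
  assume R: ?R
  show ?L
  proof (rule ccontr)
    assume "\<not> ?L"
    then have le: "D n lab k v c' w \<le> D n lab k v c w" by simp
    also note D_le_D_near[of c]
    finally have "D n lab k v c' w \<le> D_near n x lab k q v c c' c w" .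
    \<comment> \<open>The distance for \<open>c'\<close> is at most \<open>D_near\<close> for
      \<open>c\<close>, hence at most \<open>R_max\<close>, so pruning leaves it unchanged; this
      contradicts the strict inequality in \<open>?R\<close>.\<close>
    moreover from this have "D_near n x lab k q v c c' c' w = D n lab k v c' w"
      using R by (intro D_near_eq_D) (auto intro: order_trans)
    ultimately show False using R by auto
  qed
qed

end

section \<open>The pruned integral for certain and uncertain test objects\<close>

theorem theorem3p5:
  fixes \<nu> :: "'a::metric_space measure"
    and n k :: nat
    and x :: "nat \<Rightarrow> 'a uobj"
    and lab :: "nat \<Rightarrow> 'l"
    and c c' :: 'l
    and q :: "'a uobj"
  assumes "sets \<nu> = sets borel"
    and "k \<ge> 1"
    and "c \<noteq> c'"
    and "\<And>i. i < n \<Longrightarrow> lab i \<in> {c, c'}"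
    and "\<And>i. i < n \<Longrightarrow> uncertain_object \<nu> (x i)"
    and "\<And>i v. i < n \<Longrightarrow> \<exists>g. distributed (law \<nu> (x i)) lborel (dist v) g"
    and "uncertain_object \<nu> q"
  shows "over_outcomes \<nu> q (\<lambda>v.
           \<P>(w in outcomes \<nu> n x. D n lab k v c w < D n lab k v c' w)) =
         over_outcomes \<nu> q (\<lambda>v.
           LBINT R = R_min n x q..R_max n x lab k q c c'.
             prob_density (outcomes \<nu> n x) (D_near n x lab k q v c c' c) R *
             \<P>(w in outcomes \<nu> n x. D_near n x lab k q v c c' c' w > ereal R))"
proof -
  note sets_\<nu> = assms(1) and k = assms(2) and x = assms(5) and q = assms(7)
  define M where "M = outcomes \<nu> n x"
  let ?a = "R_min n x q" and ?b = "R_max n x lab k q c c'"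
  have law: "prob_space (law \<nu> (x i))" if "i < n" for i
    using that x prob_space_law by blast
  interpret prob_space M
    unfolding M_def outcomes_def using law by (intro prob_space_PiM) auto
  have dist_law: "dist v \<in> borel_measurable (law \<nu> (x i))" for v i
  proof -
    have "dist v \<in> borel_measurable borel"
      by (intro borel_measurable_continuous_onI continuous_intros)
    then show ?thesis using measurable_cong_sets[OF sets_law[OF sets_\<nu>] refl] by blast
  qed
  have dist_M: "(\<lambda>w. dist v (w i)) \<in> borel_measurable M" if "i < n" for v i
  proof -
    have "(\<lambda>w. w i) \<in> measurable M (law \<nu> (x i))"
      unfolding M_def outcomes_def using that by (intro measurable_component_singleton) simp
    from this dist_law show ?thesis by (rule measurable_compose)
  qed
  have knn_meas: "knn_dist k A v \<in> borel_measurable M" if "A \<subseteq> {..<n}" for A v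
    using that k finite_subset[OF that] by (intro borel_measurable_knn_dist dist_M) auto
  have D_meas[measurable]: "D n lab k v c0 \<in> borel_measurable M" for v c0
    unfolding D_def by (intro knn_meas) (auto simp: class_of_def)
  have Dn_meas[measurable]: "D_near n x lab k q v c c' c0 \<in> borel_measurable M" for v c0
    unfolding D_near_def by (intro knn_meas) (auto simp: T_near_def)

  \<comment> \<open>A finite value of \<open>D_near\<close> is one of finitely many distances, each
    with a Lebesgue density.\<close>
  have abs_cont: "AE w in M. D_near n x lab k q v c c' c w \<notin> ereal ` N"
    if N: "N \<in> null_sets lborel" for v and N :: "real set"
  proof -
    have "AE w in M. dist v (w i) \<notin> N" if i: "i < n" for i
    proof -
      obtain g where g: "distributed (law \<nu> (x i)) lborel (dist v) g"
        using assms(6)[OF i] by blast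
      have "AE r in lborel. r \<notin> N" using N by (rule AE_not_in)
      then have "AE r in density lborel g. r \<notin> N"
        using g by (subst AE_density) (auto simp: distributed_def)
      then have "AE r in distr (law \<nu> (x i)) lborel (dist v). r \<notin> N"
        by (simp only: distributed_distr_eq_density[OF g])
      then have "AE u in law \<nu> (x i). dist v u \<notin> N"
        using g by (intro AE_distrD[of "dist v" _ lborel]) (auto simp: distributed_def)
      then show ?thesis
        unfolding M_def outcomes_def using i law by (intro AE_PiM_component) auto
    qed
    then have "AE w in M. \<forall>i\<in>{..<n}. dist v (w i) \<notin> N"
      by (intro AE_finite_allI) auto
    then show ?thesis
    proof eventually_elim
      case (elim w)
      let ?B = "{i \<in> T_near n x lab k q c c'. lab i = c}"
      have "finite ?B" by (auto simp: T_near_def)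
      then show ?case
        using elim unfolding D_near_def
        by (cases rule: knn_dist_cases[OF \<open>finite ?B\<close> k, of v w]) (auto simp: T_near_def)
    qed
  qed
  \<comment> \<open>Real points are null sets; infinite \<open>y\<close> is excluded because
    \<open>D_near\<close> may be infinite with positive probability.\<close>
  have AE_neq: "AE w in M. D_near n x lab k q v c c' c w \<noteq> y" if "\<bar>y\<bar> \<noteq> \<infinity>" for v y
    using abs_cont[of "{real_of_ereal y}" v] that
    by (cases y) (auto simp: finite_imp_null_set_lborel)

  \<comment> \<open>\<open>T_near\<close> depends on the regions and not on outcomes, and
    \<open>c \<noteq> c'\<close> makes the two index sets disjoint.\<close>
  have "indep_var borel (D_near n x lab k q v c c' c) borel (D_near n x lab k q v c c' c')" for v
    unfolding M_def outcomes_def D_near_def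
    by (intro indep_var_knn_dist law dist_law k) (use assms(3) in \<open>auto simp: T_near_def\<close>)
  moreover have "?a \<le> ?b"
  proof -
    obtain v where "v \<in> region q" using region_nonempty[OF q] by blast
    moreover have "\<forall>i. \<exists>u. i < n \<longrightarrow> u \<in> region (x i)" using region_nonempty[OF x] by blast
    then obtain w where "\<And>i. i < n \<Longrightarrow> w i \<in> region (x i)" by metis
    ultimately show ?thesis
      using k q x by (intro R_min_le_R_max[of k q n x v w]) (auto simp: uncertain_object_def)
  qed
  \<comment> \<open>This holds for every \<open>v\<close>, inside the region of \<open>q\<close> or
    not, so it can be rewritten under the integral over \<open>v\<close>.\<close>
  ultimately have rhs: "(LBINT R=?a..?b. prob_density M (D_near n x lab k q v c c' c) R *
        \<P>(w in M. D_near n x lab k q v c c' c' w > ereal R))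
      = \<P>(w in M. ?a < D_near n x lab k q v c c' c w \<and> D_near n x lab k q v c c' c w < ?b \<and>
          D_near n x lab k q v c c' c w < D_near n x lab k q v c c' c' w)" for v
    by (intro prob_density_integral abs_cont) auto

  have AE_region: "AE w in M. \<forall>i\<in>{..<n}. w i \<in> region (x i)"
    unfolding M_def outcomes_def
    using law x sets_\<nu> by (intro AE_finite_allI AE_PiM_component AE_in_region) auto
  have pruning: "\<P>(w in M. D n lab k v c w < D n lab k v c' w)
      = \<P>(w in M. ?a < D_near n x lab k q v c c' c w \<and> D_near n x lab k q v c c' c w < ?b \<and>
          D_near n x lab k q v c c' c w < D_near n x lab k q v c c' c' w)"
    if v: "v \<in> region q" for v
  proof -
    \<comment> \<open>Finite limits are hit with probability 0, which allows passing from non-strict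
      to strict bounds.\<close>
    have a: "AE w in M. D_near n x lab k q v c c' c w \<noteq> ?a \<or> \<bar>?a\<bar> = \<infinity>"
      by (cases "\<bar>?a\<bar> = \<infinity>") (use AE_neq in auto)
    have b: "AE w in M. D_near n x lab k q v c c' c w \<noteq> ?b \<or> \<bar>?b\<bar> = \<infinity>"
      by (cases "\<bar>?b\<bar> = \<infinity>") (use AE_neq in auto)
    show ?thesis
    proof (rule finite_measure_eq_AE)
      show "AE w in M. w \<in> {w \<in> space M. D n lab k v c w < D n lab k v c' w} \<longleftrightarrow>
        w \<in> {w \<in> space M. ?a < D_near n x lab k q v c c' c w \<and> D_near n x lab k q v c c' c w < ?b \<and>
          D_near n x lab k q v c c' c w < D_near n x lab k q v c c' c' w}"
        using AE_region a b
      proof eventually_elim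
        case (elim w)
        let ?X = "D_near n x lab k q v c c' c w" and ?Y = "D_near n x lab k q v c c' c' w"
        have "D n lab k v c w < D n lab k v c' w \<longleftrightarrow> ?X \<le> ?b \<and> ?X < ?Y"
          using k q x v elim
          by (intro D_less_iff_D_near_less) (auto simp: uncertain_object_def)
        moreover have "?a \<le> ?X"
          unfolding D_near_def using k q x v elim
          by (intro R_min_le_knn_dist) (auto simp: uncertain_object_def T_near_def)
        moreover have "?X \<noteq> -\<infinity>"
        proof -
          have fin: "finite {i \<in> T_near n x lab k q c c'. lab i = c}" by (auto simp: T_near_def)
          show ?thesis unfolding D_near_def
            by (cases rule: knn_dist_cases[OF fin k, of v w]) auto
        qed
        \<comment> \<open>Infinite limits: if \<open>?b = \<infinity>\<close>, then
          \<open>?X < ?Y\<close> gives \<open>?X < ?b\<close>; if \<open>?a = \<infinity>\<close>,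
          then \<open>?X\<close> is infinite and both sides fail; the value
          \<open>-\<infinity>\<close> is settled by \<open>?X \<noteq> -\<infinity>\<close>.\<close>
        ultimately show ?case
          using elim by (cases ?a; cases ?b; cases ?X) auto
      qed
    qed measurable
  qed

  \<comment> \<open>For fixed \<open>w\<close>, strict inequalities between functions continuous in
    \<open>v\<close> give the open sections used for measurability.\<close>
  have D_cont: "continuous_on UNIV (\<lambda>v. D n lab k v c0 w)" for c0 w
    unfolding D_def by (intro continuous_on_knn_dist k) (auto simp: class_of_def)
  have Dn_cont: "continuous_on UNIV (\<lambda>v. D_near n x lab k q v c c' c0 w)" for c0 w
    unfolding D_near_def by (intro continuous_on_knn_dist k) (auto simp: T_near_def)
  have lhs_meas: "(\<lambda>v. \<P>(w in M. D n lab k v c w < D n lab k v c' w)) \<in> borel_measurable borel"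
  proof (rule borel_measurable_measure_open_sections)
    fix w assume "w \<in> space M"
    then show "open {v. w \<in> {w \<in> space M. D n lab k v c w < D n lab k v c' w}}"
      by (simp add: open_Collect_less[OF D_cont D_cont])
  qed measurable
  have rhs_meas: "(\<lambda>v. \<P>(w in M. ?a < D_near n x lab k q v c c' c w \<and>
        D_near n x lab k q v c c' c w < ?b \<and>
        D_near n x lab k q v c c' c w < D_near n x lab k q v c c' c' w)) \<in> borel_measurable borel"
  proof (rule borel_measurable_measure_open_sections)
    fix w assume "w \<in> space M"
    then show "open {v. w \<in> {w \<in> space M. ?a < D_near n x lab k q v c c' c w \<and>
        D_near n x lab k q v c c' c w < ?b \<and>
        D_near n x lab k q v c c' c w < D_near n x lab k q v c c' c' w}}"
      by (simp, intro open_Collect_conj open_Collect_less continuous_on_const Dn_cont)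
  qed measurable

  show ?thesis
  proof (cases q)
    case (Certain v)
    then show ?thesis
      using pruning[of v] rhs[of v] by (simp add: over_outcomes_def M_def)
  next
    case (Uncertain f S)
    have f: "f \<in> borel_measurable \<nu>" "\<And>v. 0 \<le> f v"
      using q Uncertain by (auto simp: uncertain_object_def)
    have "AE v in \<nu>. 0 < ennreal (f v) \<longrightarrow> v \<in> region q"
      using AE_in_region[OF sets_\<nu> q] f
      unfolding Uncertain law.simps by (subst (asm) AE_density) auto
    \<comment> \<open>Where \<open>f\<close> vanishes both integrands are 0; almost everywhere else
      \<open>v\<close> lies in the region and \<open>pruning\<close> applies.\<close>
    then have AE: "AE v in \<nu>. f v = 0 \<or> v \<in> region q"
      by eventually_elim (use f in \<open>auto simp: less_le\<close>)
    have meas_\<nu>: "h \<in> borel_measurable \<nu>" if "h \<in> borel_measurable borel" for h :: "'a \<Rightarrow> real"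
      using that measurable_cong_sets[OF sets_\<nu> refl] by blast
    show ?thesis
      unfolding over_outcomes_def Uncertain uobj.case M_def[symmetric] rhs[unfolded Uncertain]
    proof (rule integral_cong_AE)
      show "AE v in \<nu>. f v * \<P>(w in M. D n lab k v c w < D n lab k v c' w) =
        f v * \<P>(w in M. R_min n x (Uncertain f S) < D_near n x lab k (Uncertain f S) v c c' c w \<and>
          D_near n x lab k (Uncertain f S) v c c' c w < R_max n x lab k (Uncertain f S) c c' \<and>
          D_near n x lab k (Uncertain f S) v c c' c w < D_near n x lab k (Uncertain f S) v c c' c' w)"
        using AE by eventually_elim (use pruning in \<open>auto simp: Uncertain\<close>)
    qed (intro borel_measurable_times f meas_\<nu> lhs_meas rhs_meas[unfolded Uncertain])+
  qed
qed

end
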